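(* For integers $0\le k\le n$ with $k\equiv n\pmod 2$, let $n=k+2\ell$. There is a bijection $$\zeta:\mathcal{T}(n,k)\times\mathcal{C}(\ell)\to\mathcal{M}(n,k),\qquad (\alpha,\tau)\mapsto\omega,$$ satisfying $\mathsf{comaj}(\omega)=\mathsf{add}(\alpha)+\mathsf{comaj}(\tau)$.
   Context: A Motzkin path of length $n$ is a lattice path from $(0,0)$ to $(n,0)$ with steps $U=(1,1)$, $H=(1,0)$, $D=(1,-1)$ staying weakly above the $x$-axis. $\mathcal{M}(n,k)$ is the set of Motzkin paths of length $n$ with exactly $k$ $H$ steps. $\mathcal{C}(\ell)=\mathcal{M}(2\ell,0)$ is the set of Dyck paths of length $2\ell$. For a Motzkin path $p$ of length $n$, an index $i\in\{1,\dots,n-1\}$ is a weak valley if steps $i,i+1$ of $p$ are $HH$, $DU$, $DH$, or $HU$; $\mathsf{comaj}(p)$ is the sum of all weak valleys of $p$ (for a Dyck path, the sum of the indices of the valleys $DU$). $\mathcal{T}(n,m)=\{(a_1,\dots,a_m): 0\le a_1<a_2<\cdots<a_m<n\}$, a set of integer sequences ($\mathcal{T}(n,0)$ contains only the empty sequence), and $\mathsf{add}(\alpha)=a_1+\cdots+a_m$ for $\alpha=(a_1,\dots,a_m)$, with $\mathsf{add}=0$ for the empty sequence. *)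

theory Defs
  imports Main "HOL-Number_Theory.Cong" "HOL-Library.Product_Plus"
begin

datatype step = U | H | D

fun step_vec :: "step \<Rightarrow> int \<times> int" where
  "step_vec U = (1, 1)"
| "step_vec H = (1, 0)"
| "step_vec D = (1, -1)"

(* A lattice path starting at (0,0) is represented by its list of steps;
   vertex p i is the lattice point reached after the first i steps. *)
definition vertex :: "step list \<Rightarrow> nat \<Rightarrow> int \<times> int" where
  "vertex p i = (\<Sum>s\<leftarrow>take i p. step_vec s)"

definition is_motzkin_path :: "nat \<Rightarrow> step list \<Rightarrow> bool" where
  "is_motzkin_path n p \<longleftrightarrow>
     vertex p (length p) = (int n, 0) \<and> (\<forall>i\<le>length p. snd (vertex p i) \<ge> 0)"

definition motzkin_paths :: "nat \<Rightarrow> nat \<Rightarrow> step list set" where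
  "motzkin_paths n k = {p. is_motzkin_path n p \<and> count_list p H = k}"

definition dyck_paths :: "nat \<Rightarrow> step list set" where
  "dyck_paths l = motzkin_paths (2 * l) 0"

(* Steps are numbered from 1, list positions from 0: step i of p is p ! (i - 1). *)
definition weak_valleys :: "step list \<Rightarrow> nat set" where
  "weak_valleys p = {i. 1 \<le> i \<and> i < length p \<and>
     (p ! (i - 1), p ! i) \<in> {(H, H), (D, U), (D, H), (H, U)}}"

definition comaj :: "step list \<Rightarrow> nat" where
  "comaj p = \<Sum> (weak_valleys p)"

definition increasing_seqs :: "nat \<Rightarrow> nat \<Rightarrow> nat list set" where
  "increasing_seqs n m = {a. length a = m \<and> sorted_wrt (<) a \<and> (\<forall>x\<in>set a. x < n)}"

definition add :: "nat list \<Rightarrow> nat" where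
  "add a = sum_list a"

end

theory Submission
  imports Defs "HOL-Computational_Algebra.Polynomial"
begin

text \<open>
  Deleting the \<open>H\<close> steps of a Motzkin path leaves a Dyck path, and reinserting them anywhere keeps
  the path Motzkin. So it suffices to treat a fixed word \<open>\<tau>\<close> in \<open>U\<close>, \<open>D\<close> and to compare the
  distribution of \<open>comaj\<close> over all insertions of \<open>k\<close> copies of \<open>H\<close> into \<open>\<tau>\<close> with that of \<open>add\<close>
  over increasing sequences. Conditioning on the last letter, the pair of generating functions of
  \<open>comaj w\<close> and of \<open>comaj (w @ [H])\<close> obeys recurrences that are solved by the two \<open>q\<close>-Pascal rules
  (split the sequences by their largest possible entry, or by whether they start with \<open>0\<close>).
  Equal generating functions give a weight-preserving bijection.
\<close>

section \<open>Generating functions and bijections\<close>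

lemma coeff_sum_X_power:
  assumes "finite A"
  shows "coeff (\<Sum>x\<in>A. [:0, 1::nat:] ^ f x) m = card {x \<in> A. f x = m}"
proof -
  have "[:0, 1::nat:] ^ j = monom 1 j" for j
    by (simp add: monom_altdef del: One_nat_def)
  then have "coeff (\<Sum>x\<in>A. [:0, 1::nat:] ^ f x) m = (\<Sum>x\<in>A. if f x = m then 1 else 0)"
    by (simp add: coeff_sum del: One_nat_def)
  also have "\<dots> = card {x \<in> A. f x = m}"
    using assms by (simp add: sum.If_cases Int_def)
  finally show ?thesis .
qed

text \<open>Comparing coefficients with \<open>coeff_sum_X_power\<close> shows that the fibres of
  \<open>f\<close> and \<open>g\<close> over each weight \<open>m\<close> are equinumerous; the
  bijections \<open>h m\<close> between the fibres are then glued together.\<close>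

lemma weight_preserving_bij:
  assumes "finite A" "finite B"
    and "(\<Sum>x\<in>A. [:0, 1::nat:] ^ f x) = (\<Sum>y\<in>B. [:0, 1::nat:] ^ g y)"
  obtains h where "bij_betw h A B" and "\<And>x. x \<in> A \<Longrightarrow> g (h x) = f x"
proof -
  have "\<exists>h. bij_betw h {x \<in> A. f x = m} {y \<in> B. g y = m}" for m
    using assms by (intro finite_same_card_bij) (auto simp flip: coeff_sum_X_power)
  then obtain h where h: "\<And>m. bij_betw (h m) {x \<in> A. f x = m} {y \<in> B. g y = m}"
    by metis
  have weight: "h (f x) x \<in> B \<and> g (h (f x) x) = f x" if "x \<in> A" for x
    using bij_betwE[OF h[of "f x"]] that by auto
  have "bij_betw (\<lambda>x. h (f x) x) A B"
  proof (rule bij_betw_imageI)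
    show "inj_on (\<lambda>x. h (f x) x) A"
    proof (rule inj_onI)
      fix x y
      assume xy: "x \<in> A" "y \<in> A" "h (f x) x = h (f y) y"
      then have "f x = f y"
        using weight by metis
      with xy show "x = y"
        using bij_betw_imp_inj_on[OF h[of "f x"]] by (auto dest: inj_onD)
    qed
    have "y \<in> (\<lambda>x. h (f x) x) ` A" if "y \<in> B" for y
    proof -
      have "y \<in> h (g y) ` {x \<in> A. f x = g y}"
        using bij_betw_imp_surj_on[OF h[of "g y"]] that by auto
      then show ?thesis by force
    qed
    then show "(\<lambda>x. h (f x) x) ` A = B"
      using weight by blast
  qed
  with weight show ?thesis
    using that by blast
qed

section \<open>Increasing sequences\<close>

text \<open>This is the Gaussian binomial coefficient of \<open>n\<close> over \<open>k\<close>
  times \<open>q ^ (k choose 2)\<close>; a general semiring element \<open>q\<close> keeps the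
  recurrences free of polynomial notation.\<close>

definition seq_gf :: "'a::comm_semiring_1 \<Rightarrow> nat \<Rightarrow> nat \<Rightarrow> 'a" where
  "seq_gf q n k = (\<Sum>a\<in>increasing_seqs n k. q ^ add a)"

lemma finite_increasing_seqs: "finite (increasing_seqs n k)"
proof (rule finite_subset)
  show "increasing_seqs n k \<subseteq> {a. set a \<subseteq> {..<n} \<and> length a = k}"
    by (auto simp: increasing_seqs_def)
qed (simp add: finite_lists_length_eq)

lemma increasing_seqs_zero: "increasing_seqs n 0 = {[]}"
  by (auto simp: increasing_seqs_def)

lemma increasing_seqs_empty:
  assumes "n < k"
  shows "increasing_seqs n k = {}"
proof -
  have False if "a \<in> increasing_seqs n k" for a
  proof -
    have a: "length a = k" "distinct a" "set a \<subseteq> {..<n}"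
      using that by (auto simp: increasing_seqs_def strict_sorted_iff)
    then have "k \<le> n"
      using card_mono[of "{..<n}" "set a"] by (simp add: distinct_card)
    with assms show False by simp
  qed
  then show ?thesis by blast
qed

text \<open>The value \<open>n\<close> is the largest one allowed, so it can occur only in last
  position.\<close>

lemma increasing_seqs_split_last:
  "increasing_seqs (Suc n) (Suc k) =
     increasing_seqs n (Suc k) \<union> (\<lambda>a. a @ [n]) ` increasing_seqs n k"
proof (intro subset_antisym subsetI)
  fix a
  assume a: "a \<in> increasing_seqs (Suc n) (Suc k)"
  then obtain b x where ab: "a = b @ [x]"
    by (cases a rule: rev_cases) (auto simp: increasing_seqs_def)
  have b: "length b = k" "sorted_wrt (<) b" "\<forall>y\<in>set b. y < x" "x < Suc n"
    using a by (auto simp: ab increasing_seqs_def sorted_wrt_append)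
  show "a \<in> increasing_seqs n (Suc k) \<union> (\<lambda>a. a @ [n]) ` increasing_seqs n k"
  proof (cases "x = n")
    case True
    then show ?thesis
      using b by (auto simp: ab increasing_seqs_def)
  next
    case False
    then show ?thesis
      using b by (force simp: ab increasing_seqs_def sorted_wrt_append)
  qed
qed (auto simp: increasing_seqs_def sorted_wrt_append less_SucI)

text \<open>The value \<open>0\<close> can occur only in first position; all other entries are
  positive and can be lowered by one.\<close>

lemma increasing_seqs_split_first:
  "increasing_seqs (Suc n) (Suc k) =
     map Suc ` increasing_seqs n (Suc k) \<union> (\<lambda>a. 0 # map Suc a) ` increasing_seqs n k"
proof (intro subset_antisym subsetI)
  have shift: "a \<in> map Suc ` increasing_seqs n j"
    if "length a = j" "sorted_wrt (<) a" "\<forall>y\<in>set a. 0 < y \<and> y < Suc n" for a j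
  proof
    show "a = map Suc (map (\<lambda>y. y - 1) a)"
      using that by (simp add: map_idI)
    show "map (\<lambda>y. y - 1) a \<in> increasing_seqs n j"
      using that
      by (auto simp: increasing_seqs_def sorted_wrt_map intro!: sorted_wrt_mono_rel[of a "(<)"])
  qed
  fix a
  assume a: "a \<in> increasing_seqs (Suc n) (Suc k)"
  then obtain b x where ab: "a = x # b"
    by (cases a) (auto simp: increasing_seqs_def)
  show "a \<in> map Suc ` increasing_seqs n (Suc k) \<union> (\<lambda>a. 0 # map Suc a) ` increasing_seqs n k"
  proof (cases "x = 0")
    case True
    then have "b \<in> map Suc ` increasing_seqs n k"
      using a by (intro shift) (auto simp: ab increasing_seqs_def)
    then show ?thesis
      using True by (auto simp: ab)
  next
    case False
    then have "a \<in> map Suc ` increasing_seqs n (Suc k)"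
      using a by (intro shift) (auto simp: ab increasing_seqs_def)
    then show ?thesis by simp
  qed
qed (auto simp: increasing_seqs_def sorted_wrt_map)

lemma seq_gf_zero [simp]: "seq_gf q n 0 = 1"
  by (simp add: seq_gf_def increasing_seqs_zero add_def)

lemma seq_gf_less [simp]: "n < k \<Longrightarrow> seq_gf q n k = 0"
  by (simp add: seq_gf_def increasing_seqs_empty)

lemma seq_gf_split_last:
  "seq_gf q (Suc n) (Suc k) = seq_gf q n (Suc k) + q ^ n * seq_gf q n k"
proof -
  have "seq_gf q (Suc n) (Suc k) = seq_gf q n (Suc k) +
      (\<Sum>a\<in>(\<lambda>a. a @ [n]) ` increasing_seqs n k. q ^ add a)"
    unfolding seq_gf_def increasing_seqs_split_last
    by (rule sum.union_disjoint) (auto simp: finite_increasing_seqs, auto simp: increasing_seqs_def)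
  also have "(\<Sum>a\<in>(\<lambda>a. a @ [n]) ` increasing_seqs n k. q ^ add a) = q ^ n * seq_gf q n k"
    by (simp add: seq_gf_def sum.reindex inj_on_def sum_distrib_left add_def power_add mult.commute)
  finally show ?thesis .
qed

lemma add_map_Suc: "add (map Suc a) = length a + add a"
  by (induction a) (auto simp: add_def)

text \<open>The second \<open>q\<close>-Pascal rule: raising every entry of a sequence of length
  \<open>j\<close> by one multiplies its weight by \<open>q ^ j\<close>.\<close>

lemma seq_gf_split_first:
  "seq_gf q (Suc n) (Suc k) = q ^ Suc k * seq_gf q n (Suc k) + q ^ k * seq_gf q n k"
proof -
  have len: "length a = j" if "a \<in> increasing_seqs n j" for a j
    using that by (simp add: increasing_seqs_def)
  have "seq_gf q (Suc n) (Suc k) = (\<Sum>a\<in>map Suc ` increasing_seqs n (Suc k). q ^ add a) +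
      (\<Sum>a\<in>(\<lambda>a. 0 # map Suc a) ` increasing_seqs n k. q ^ add a)"
    unfolding seq_gf_def increasing_seqs_split_first
    by (rule sum.union_disjoint) (auto simp: finite_increasing_seqs)
  also have "(\<Sum>a\<in>map Suc ` increasing_seqs n (Suc k). q ^ add a) =
      (\<Sum>a\<in>increasing_seqs n (Suc k). q ^ Suc k * q ^ add a)"
    by (subst sum.reindex) (auto simp: inj_on_def len add_map_Suc power_add mult.assoc intro!: sum.cong)
  also have "(\<Sum>a\<in>(\<lambda>a. 0 # map Suc a) ` increasing_seqs n k. q ^ add a) =
      (\<Sum>a\<in>increasing_seqs n k. q ^ add (map Suc a))"
    by (subst sum.reindex) (auto simp: inj_on_def add_def)
  also have "\<dots> = (\<Sum>a\<in>increasing_seqs n k. q ^ k * q ^ add a)"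
    by (auto simp: len add_map_Suc power_add intro!: sum.cong)
  finally show ?thesis
    by (simp add: seq_gf_def sum_distrib_left)
qed

section \<open>Inserting horizontal steps\<close>

definition erase_H :: "step list \<Rightarrow> step list" where
  "erase_H = filter (\<lambda>s. s \<noteq> H)"

definition insertions :: "step list \<Rightarrow> nat \<Rightarrow> step list set" where
  "insertions \<tau> k = {w. erase_H w = \<tau> \<and> count_list w H = k}"

lemma length_erase_H: "length w = length (erase_H w) + count_list w H"
  by (induction w) (auto simp: erase_H_def)

lemma length_insertions: "w \<in> insertions \<tau> k \<Longrightarrow> length w = length \<tau> + k"
  using length_erase_H[of w] by (auto simp: insertions_def)

lemma finite_insertions: "finite (insertions \<tau> k)"
proof (rule finite_subset)
  have "UNIV = {U, H, D}"
    using step.exhaust by auto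
  then have "finite (UNIV :: step set)"
    by (metis finite.emptyI finite.insertI)
  then show "finite {w. set w \<subseteq> (UNIV :: step set) \<and> length w = length \<tau> + k}"
    by (rule finite_lists_length_eq)
  show "insertions \<tau> k \<subseteq> {w. set w \<subseteq> UNIV \<and> length w = length \<tau> + k}"
    by (auto simp: length_insertions)
qed

text \<open>The four weak valley patterns are exactly the pairs whose first step is not
  \<open>U\<close> and whose second is not \<open>D\<close>, so a new last step creates at most one
  weak valley, at index \<open>length w\<close>.\<close>

lemma comaj_snoc:
  "comaj (w @ [x]) = comaj w + (if w \<noteq> [] \<and> last w \<noteq> U \<and> x \<noteq> D then length w else 0)"
proof -
  let ?N = "if w \<noteq> [] \<and> last w \<noteq> U \<and> x \<noteq> D then {length w} else {}"
  have fin: "finite (weak_valleys w)"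
    by (rule finite_subset[of _ "{..length w}"]) (auto simp: weak_valleys_def)
  have new: "(last w, x) \<in> {(H, H), (D, U), (D, H), (H, U)} \<longleftrightarrow> last w \<noteq> U \<and> x \<noteq> D"
    by (cases "last w"; cases x) auto
  have "weak_valleys (w @ [x]) = weak_valleys w \<union> ?N"
  proof (rule set_eqI)
    fix i
    consider "i = 0" | "1 \<le> i" "i < length w" | "1 \<le> i" "i = length w" | "i > length w"
      by linarith
    then show "i \<in> weak_valleys (w @ [x]) \<longleftrightarrow> i \<in> weak_valleys w \<union> ?N"
    proof cases
      case 3
      then have "(w @ [x]) ! (i - 1) = last w" "(w @ [x]) ! i = x" "w \<noteq> []"
        by (simp_all add: nth_append last_conv_nth flip: length_greater_0_conv)
      then show ?thesis
        using 3 new by (auto simp: weak_valleys_def)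
    qed (auto simp: weak_valleys_def nth_append)
  qed
  moreover have "weak_valleys w \<inter> ?N = {}"
    by (auto simp: weak_valleys_def)
  ultimately show ?thesis
    using fin by (simp add: comaj_def sum.union_disjoint)
qed

lemma comaj_Nil [simp]: "comaj [] = 0"
  by (simp add: comaj_def weak_valleys_def)

lemma comaj_singleton [simp]: "comaj [x] = 0"
  using comaj_snoc[of "[]" x] by simp

section \<open>Splitting the inserted words by their last step\<close>

lemma insertions_Nil: "insertions [] k = {replicate k H}"
proof -
  have "w = replicate k H" if "erase_H w = []" "count_list w H = k" for w
  proof (rule replicate_eqI)
    show "length w = k"
      using that length_erase_H[of w] by simp
    show "s = H" if "s \<in> set w" for s
      using \<open>erase_H w = []\<close> that by (auto simp: erase_H_def filter_empty_conv)
  qed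
  moreover have "count_list (replicate k H) H = k"
    by (induction k) auto
  ultimately show ?thesis
    by (auto simp: insertions_def erase_H_def)
qed

lemma insertions_snoc_zero:
  assumes "x \<noteq> H"
  shows "insertions (\<tau> @ [x]) 0 = (\<lambda>w. w @ [x]) ` insertions \<tau> 0"
proof (intro subset_antisym subsetI)
  fix w
  assume w: "w \<in> insertions (\<tau> @ [x]) 0"
  then obtain v y where wv: "w = v @ [y]"
    by (cases w rule: rev_cases) (auto simp: insertions_def erase_H_def)
  with w show "w \<in> (\<lambda>w. w @ [x]) ` insertions \<tau> 0"
    by (cases "y = H") (auto simp: insertions_def erase_H_def)
qed (use assms in \<open>auto simp: insertions_def erase_H_def\<close>)

text \<open>The last step of such a word is either the last letter \<open>x\<close> of the
  underlying word or an inserted \<open>H\<close>.\<close>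

lemma insertions_snoc_Suc:
  assumes "x \<noteq> H"
  shows "insertions (\<tau> @ [x]) (Suc k) =
    (\<lambda>w. w @ [x]) ` insertions \<tau> (Suc k) \<union> (\<lambda>w. w @ [H]) ` insertions (\<tau> @ [x]) k"
proof (intro subset_antisym subsetI)
  fix w
  assume w: "w \<in> insertions (\<tau> @ [x]) (Suc k)"
  then obtain v y where wv: "w = v @ [y]"
    by (cases w rule: rev_cases) (auto simp: insertions_def erase_H_def)
  with w show "w \<in> (\<lambda>w. w @ [x]) ` insertions \<tau> (Suc k) \<union>
      (\<lambda>w. w @ [H]) ` insertions (\<tau> @ [x]) k"
    by (cases "y = H") (auto simp: insertions_def erase_H_def)
qed (use assms in \<open>auto simp: insertions_def erase_H_def\<close>)

lemma sum_insertions_zero: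
  assumes "x \<noteq> H"
  shows "(\<Sum>w\<in>insertions (\<tau> @ [x]) 0. f w) = (\<Sum>w\<in>insertions \<tau> 0. f (w @ [x]))"
  unfolding insertions_snoc_zero[OF assms] by (subst sum.reindex) (auto simp: inj_on_def)

lemma sum_insertions_Suc:
  assumes "x \<noteq> H"
  shows "(\<Sum>w\<in>insertions (\<tau> @ [x]) (Suc k). f w) =
    (\<Sum>w\<in>insertions \<tau> (Suc k). f (w @ [x])) + (\<Sum>w\<in>insertions (\<tau> @ [x]) k. f (w @ [H]))"
proof -
  have "(\<Sum>w\<in>insertions (\<tau> @ [x]) (Suc k). f w) =
      (\<Sum>w\<in>(\<lambda>w. w @ [x]) ` insertions \<tau> (Suc k). f w) +
      (\<Sum>w\<in>(\<lambda>w. w @ [H]) ` insertions (\<tau> @ [x]) k. f w)"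
    unfolding insertions_snoc_Suc[OF assms]
    using assms by (intro sum.union_disjoint) (auto simp: finite_insertions)
  then show ?thesis
    by (simp add: sum.reindex inj_on_def)
qed

section \<open>Recurrences and closed forms for the two generating functions\<close>

definition comaj_gf :: "'a::comm_semiring_1 \<Rightarrow> step list \<Rightarrow> nat \<Rightarrow> 'a" where
  "comaj_gf q \<tau> k = (\<Sum>w\<in>insertions \<tau> k. q ^ comaj w)"

text \<open>The final \<open>H\<close> is not among the \<open>k\<close> inserted ones. This second
  function records whether \<open>w\<close> ends in \<open>U\<close>, which decides if a following
  \<open>H\<close> or \<open>U\<close> creates a weak valley.\<close>

definition comaj_gf_H :: "'a::comm_semiring_1 \<Rightarrow> step list \<Rightarrow> nat \<Rightarrow> 'a" where
  "comaj_gf_H q \<tau> k = (\<Sum>w\<in>insertions \<tau> k. q ^ comaj (w @ [H]))"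

lemma comaj_snoc_D: "comaj (w @ [D]) = comaj w"
  by (simp add: comaj_snoc)

lemma comaj_snoc_U: "comaj (w @ [U]) = comaj (w @ [H])"
  by (simp add: comaj_snoc)

lemma comaj_gf_snoc_D_zero: "comaj_gf q (\<tau> @ [D]) 0 = comaj_gf q \<tau> 0"
  by (simp add: comaj_gf_def sum_insertions_zero comaj_snoc_D)

lemma comaj_gf_snoc_D_Suc:
  "comaj_gf q (\<tau> @ [D]) (Suc k) = comaj_gf q \<tau> (Suc k) + comaj_gf_H q (\<tau> @ [D]) k"
  by (simp add: comaj_gf_def comaj_gf_H_def sum_insertions_Suc comaj_snoc_D)

lemma comaj_gf_snoc_U_zero: "comaj_gf q (\<tau> @ [U]) 0 = comaj_gf_H q \<tau> 0"
  by (simp add: comaj_gf_def comaj_gf_H_def sum_insertions_zero comaj_snoc_U)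

lemma comaj_gf_snoc_U_Suc:
  "comaj_gf q (\<tau> @ [U]) (Suc k) = comaj_gf_H q \<tau> (Suc k) + comaj_gf_H q (\<tau> @ [U]) k"
  by (simp add: comaj_gf_def comaj_gf_H_def sum_insertions_Suc comaj_snoc_U)

lemma comaj_snoc_H_H: "comaj ((w @ [H]) @ [H]) = comaj (w @ [H]) + Suc (length w)"
  by (subst comaj_snoc) simp

text \<open>No weak valley begins with \<open>U\<close>, and a final \<open>U\<close> contributes as
  much as a final \<open>H\<close>.\<close>

lemma comaj_snoc_U_H: "comaj ((w @ [U]) @ [H]) = comaj (w @ [H])"
  by (subst comaj_snoc) (simp add: comaj_snoc_U)

lemma comaj_gf_H_snoc_U_zero: "comaj_gf_H q (\<tau> @ [U]) 0 = comaj_gf_H q \<tau> 0"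
  by (simp only: comaj_gf_H_def sum_insertions_zero step.distinct not_False_eq_True comaj_snoc_U_H)

lemma comaj_gf_H_snoc_U_Suc:
  "comaj_gf_H q (\<tau> @ [U]) (Suc k) =
     comaj_gf_H q \<tau> (Suc k) + q ^ (length \<tau> + k + 2) * comaj_gf_H q (\<tau> @ [U]) k"
proof -
  \<comment> \<open>Here \<open>w\<close> has length \<open>length \<tau> + 1 + k\<close>, so the
    weak valley between the two final \<open>H\<close> steps has index
    \<open>length \<tau> + k + 2\<close>.\<close>
  have "(\<Sum>w\<in>insertions (\<tau> @ [U]) k. q ^ comaj ((w @ [H]) @ [H])) =
      (\<Sum>w\<in>insertions (\<tau> @ [U]) k. q ^ (length \<tau> + k + 2) * q ^ comaj (w @ [H]))"
    by (intro sum.cong refl, subst comaj_snoc_H_H)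
      (simp add: length_insertions power_add algebra_simps)
  then show ?thesis
    by (simp only: comaj_gf_H_def sum_insertions_Suc step.distinct not_False_eq_True
        comaj_snoc_U_H sum_distrib_left)
qed

text \<open>A word whose erasure ends in \<open>D\<close> ends in \<open>D\<close> or
  \<open>H\<close>, so appending \<open>H\<close> always creates a weak valley, at the length of the
  word.\<close>

lemma comaj_gf_H_snoc_D:
  "comaj_gf_H q (\<tau> @ [D]) k = q ^ (length \<tau> + 1 + k) * comaj_gf q (\<tau> @ [D]) k"
proof -
  have "comaj (w @ [H]) = length \<tau> + 1 + k + comaj w" if w: "w \<in> insertions (\<tau> @ [D]) k" for w
  proof -
    obtain v y where "w = v @ [y]"
      using w by (cases w rule: rev_cases) (auto simp: insertions_def erase_H_def)
    then have "w \<noteq> []" "last w \<noteq> U"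
      using w by (auto simp: insertions_def erase_H_def split: if_splits)
    then show ?thesis
      using length_insertions[OF w] by (simp add: comaj_snoc)
  qed
  then show ?thesis
    by (simp add: comaj_gf_def comaj_gf_H_def sum_distrib_left power_add mult.assoc)
qed

text \<open>There is one word, \<open>k\<close> times \<open>H\<close>, with weak valleys 1, ...,
  \<open>k - 1\<close>, and one sequence, 0, ..., \<open>k - 1\<close>. In the induction the term
  \<open>seq_gf q k (Suc k)\<close> of the \<open>q\<close>-Pascal rule vanishes.\<close>

lemma comaj_gf_Nil:
  "comaj_gf q [] k = seq_gf q k k" "comaj_gf_H q [] k = q ^ k * seq_gf q k k"
proof -
  have H: "comaj (replicate k H @ [H]) = k + comaj (replicate k H)" for k
    by (cases "k = 0") (simp_all add: comaj_snoc last_replicate)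
  have *: "q ^ comaj (replicate k H) = seq_gf q k k"
  proof (induction k)
    case (Suc k)
    have "comaj (replicate (Suc k) H) = k + comaj (replicate k H)"
      by (simp add: H flip: replicate_append_same)
    then show ?case
      using Suc by (simp add: power_add seq_gf_split_last)
  qed simp
  show "comaj_gf q [] k = seq_gf q k k" "comaj_gf_H q [] k = q ^ k * seq_gf q k k"
    using * by (simp_all add: comaj_gf_def comaj_gf_H_def insertions_Nil H power_add)
qed

text \<open>
  The factor \<open>q ^ comaj (\<tau> @ [U])\<close> covers at once the cases where \<open>\<tau>\<close> does or does not end in \<open>D\<close>.
\<close>

lemma comaj_gf_eq:
  assumes "H \<notin> set \<tau>"
  shows "comaj_gf q \<tau> k = q ^ comaj \<tau> * seq_gf q (length \<tau> + k) k \<and>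
    comaj_gf_H q \<tau> k = q ^ (k + comaj (\<tau> @ [U])) * seq_gf q (length \<tau> + k) k"
  using assms
proof (induction \<tau> arbitrary: k rule: rev_induct)
  case Nil
  then show ?case
    by (simp add: comaj_gf_Nil)
next
  case (snoc x \<tau>)
  then have IH: "comaj_gf q \<tau> k = q ^ comaj \<tau> * seq_gf q (length \<tau> + k) k"
    "comaj_gf_H q \<tau> k = q ^ (k + comaj (\<tau> @ [U])) * seq_gf q (length \<tau> + k) k" for k
    by simp_all
  show ?case
  proof (cases x)
    case U
    have same: "comaj ((\<tau> @ [U]) @ [U]) = comaj (\<tau> @ [U])"
      by (subst comaj_snoc) simp
    \<comment> \<open>The common factor \<open>q ^ (Suc k + comaj (\<tau> @ [U]))\<close> leaves
      exactly the rule that splits by the last entry.\<close>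
    have gf_H: "comaj_gf_H q (\<tau> @ [U]) k =
        q ^ (k + comaj (\<tau> @ [U])) * seq_gf q (Suc (length \<tau>) + k) k" for k
    proof (induction k)
      case 0
      then show ?case by (simp add: comaj_gf_H_snoc_U_zero IH)
    next
      case (Suc k)
      show ?case
        using seq_gf_split_last[of q "Suc (length \<tau> + k)" k]
        by (simp add: comaj_gf_H_snoc_U_Suc IH Suc power_add algebra_simps)
    qed
    \<comment> \<open>Both summands are now known from \<open>IH\<close> and \<open>gf_H\<close>;
      their factors \<open>q ^ Suc j\<close> and \<open>q ^ j\<close> are those of the rule that
      splits by the first entry.\<close>
    have "comaj_gf q (\<tau> @ [U]) k = q ^ comaj (\<tau> @ [U]) * seq_gf q (Suc (length \<tau>) + k) k"
    proof (cases k)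
      case 0
      then show ?thesis by (simp add: comaj_gf_snoc_U_zero IH)
    next
      case (Suc j)
      then show ?thesis
        using seq_gf_split_first[of q "Suc (length \<tau> + j)" j]
        by (simp add: comaj_gf_snoc_U_Suc IH gf_H power_add algebra_simps)
    qed
    then show ?thesis
      using U gf_H same by simp
  next
    case H
    then show ?thesis using snoc.prems by simp
  next
    case D
    have gf: "comaj_gf q (\<tau> @ [D]) k = q ^ comaj \<tau> * seq_gf q (Suc (length \<tau>) + k) k" for k
    proof (induction k)
      case 0
      then show ?case by (simp add: comaj_gf_snoc_D_zero IH)
    next
      case (Suc k)
      then show ?case
        using seq_gf_split_last[of q "Suc (length \<tau> + k)" k]
        by (simp add: comaj_gf_snoc_D_Suc comaj_gf_H_snoc_D IH power_add algebra_simps)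
    qed
    \<comment> \<open>The valley \<open>DU\<close> at index \<open>Suc (length \<tau>)\<close>
      accounts for the power of \<open>q\<close> in \<open>comaj_gf_H_snoc_D\<close>, apart from
      \<open>q ^ k\<close>.\<close>
    have "comaj ((\<tau> @ [D]) @ [U]) = Suc (length \<tau>) + comaj \<tau>"
      by (subst comaj_snoc) (simp add: comaj_snoc_D)
    then show ?thesis
      using D gf by (simp add: comaj_snoc_D comaj_gf_H_snoc_D power_add algebra_simps)
  qed
qed

section \<open>Motzkin paths as insertions into Dyck paths\<close>

definition height :: "step list \<Rightarrow> int" where
  "height p = snd (\<Sum>s\<leftarrow>p. step_vec s)"

lemma height_append: "height (p @ r) = height p + height r"
  by (simp add: height_def)

lemma height_H [simp]: "height [H] = 0"
  by (simp add: height_def)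

lemma height_erase_H: "height (erase_H p) = height p"
  by (induction p) (auto simp: height_def erase_H_def)

lemma fst_sum_step_vec: "fst (\<Sum>s\<leftarrow>p. step_vec s) = int (length p)"
proof (induction p)
  case (Cons s p)
  then show ?case by (cases s) auto
qed simp

lemma is_motzkin_path_iff:
  "is_motzkin_path n p \<longleftrightarrow>
     length p = n \<and> height p = 0 \<and> (\<forall>i\<le>length p. height (take i p) \<ge> 0)"
  by (auto simp: is_motzkin_path_def vertex_def height_def prod_eq_iff fst_sum_step_vec)

lemma nonneg_prefixes_snoc:
  "(\<forall>i\<le>length (p @ [x]). height (take i (p @ [x])) \<ge> 0) \<longleftrightarrow>
     (\<forall>i\<le>length p. height (take i p) \<ge> 0) \<and> height (p @ [x]) \<ge> 0"
  by (auto simp: le_Suc_eq)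

text \<open>An \<open>H\<close> step only repeats the height reached before it, so it adds no new
  condition on the prefixes.\<close>

lemma nonneg_prefixes_erase_H:
  "(\<forall>i\<le>length (erase_H p). height (take i (erase_H p)) \<ge> 0) \<longleftrightarrow>
     (\<forall>i\<le>length p. height (take i p) \<ge> 0)"
proof (induction p rule: rev_induct)
  case Nil
  then show ?case by (simp add: erase_H_def)
next
  case (snoc x p)
  show ?case
  proof (cases "x = H")
    case True
    have "height p \<ge> 0" if "\<forall>i\<le>length p. height (take i p) \<ge> 0"
      using that by (metis order_refl take_all_iff)
    moreover have "erase_H (p @ [x]) = erase_H p"
      using True by (simp add: erase_H_def)
    ultimately show ?thesis
      using snoc True unfolding nonneg_prefixes_snoc by (auto simp: height_append)
  next
    case False
    then have "erase_H (p @ [x]) = erase_H p @ [x]"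
      by (simp add: erase_H_def)
    then show ?thesis
      using snoc by (simp only: nonneg_prefixes_snoc height_append height_erase_H)
  qed
qed

lemma is_motzkin_path_erase_H:
  assumes "count_list p H = k"
  shows "is_motzkin_path (k + m) p \<longleftrightarrow> is_motzkin_path m (erase_H p)"
  using assms nonneg_prefixes_erase_H[of p] length_erase_H[of p]
  by (auto simp: is_motzkin_path_iff height_erase_H)

text \<open>The union is disjoint, since \<open>erase_H\<close> recovers \<open>\<tau>\<close>;
  hence a bijection may be chosen for each Dyck path separately.\<close>

lemma motzkin_paths_eq_insertions:
  "motzkin_paths (k + 2 * l) k = (\<Union>\<tau>\<in>dyck_paths l. insertions \<tau> k)"
proof -
  have "count_list (erase_H p) H = 0" for p
    by (simp add: count_list_0_iff erase_H_def)
  then show ?thesis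
    by (auto simp: motzkin_paths_def dyck_paths_def insertions_def is_motzkin_path_erase_H)
qed

theorem theorem4p4:
  fixes n k l :: nat
  assumes "k \<le> n" and "[k = n] (mod 2)" and "n = k + 2 * l"
  shows "\<exists>\<zeta> :: nat list \<times> step list \<Rightarrow> step list.
           bij_betw \<zeta> (increasing_seqs n k \<times> dyck_paths l) (motzkin_paths n k) \<and>
           (\<forall>\<alpha>\<in>increasing_seqs n k. \<forall>\<tau>\<in>dyck_paths l.
              comaj (\<zeta> (\<alpha>, \<tau>)) = add \<alpha> + comaj \<tau>)"
proof -
  have "\<exists>h. bij_betw h (increasing_seqs n k) (insertions \<tau> k) \<and>
      (\<forall>\<alpha>\<in>increasing_seqs n k. comaj (h \<alpha>) = add \<alpha> + comaj \<tau>)"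
    if \<tau>: "\<tau> \<in> dyck_paths l" for \<tau>
  proof -
    \<comment> \<open>Taking \<open>q\<close> to be the indeterminate over the natural numbers turns
      the identity into an equality of cardinalities weight by weight.\<close>
    let ?X = "[:0, 1::nat:]"
    have "length \<tau> + k = n" "H \<notin> set \<tau>"
      using \<tau> assms(3)
      by (auto simp: dyck_paths_def motzkin_paths_def is_motzkin_path_iff count_list_0_iff)
    then have "comaj_gf ?X \<tau> k = ?X ^ comaj \<tau> * seq_gf ?X n k"
      using comaj_gf_eq by blast
    \<comment> \<open>The factor \<open>?X ^ comaj \<tau>\<close> is absorbed into the weight of
      \<open>\<alpha>\<close> as a constant shift.\<close>
    then have "(\<Sum>\<alpha>\<in>increasing_seqs n k. ?X ^ (add \<alpha> + comaj \<tau>)) =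
        (\<Sum>w\<in>insertions \<tau> k. ?X ^ comaj w)"
      by (simp add: comaj_gf_def seq_gf_def sum_distrib_left power_add mult.commute)
    from weight_preserving_bij[OF finite_increasing_seqs finite_insertions this]
    show ?thesis by metis
  qed
  then obtain h where
    h: "\<And>\<tau>. \<tau> \<in> dyck_paths l \<Longrightarrow> bij_betw (h \<tau>) (increasing_seqs n k) (insertions \<tau> k)" and
    weight: "\<And>\<tau> \<alpha>. \<tau> \<in> dyck_paths l \<Longrightarrow> \<alpha> \<in> increasing_seqs n k \<Longrightarrow>
      comaj (h \<tau> \<alpha>) = add \<alpha> + comaj \<tau>"
    by metis
  let ?z = "\<lambda>(\<alpha>, \<tau>). h \<tau> \<alpha>"
  \<comment> \<open>The image path determines \<open>\<tau>\<close>, so injectivity reduces to that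
    of each single \<open>h \<tau>\<close>.\<close>
  have erase: "erase_H (h \<tau> \<alpha>) = \<tau>" if "\<tau> \<in> dyck_paths l" "\<alpha> \<in> increasing_seqs n k" for \<tau> \<alpha>
    using bij_betwE[OF h] that by (auto simp: insertions_def)
  have "bij_betw ?z (increasing_seqs n k \<times> dyck_paths l) (motzkin_paths n k)"
  proof (rule bij_betw_imageI)
    show "inj_on ?z (increasing_seqs n k \<times> dyck_paths l)"
    proof (rule inj_onI, clarify)
      fix \<alpha> \<tau> \<beta> \<sigma>
      assume *: "\<alpha> \<in> increasing_seqs n k" "\<tau> \<in> dyck_paths l"
        "\<beta> \<in> increasing_seqs n k" "\<sigma> \<in> dyck_paths l" "h \<tau> \<alpha> = h \<sigma> \<beta>"
      then have "\<tau> = \<sigma>"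
        using erase by metis
      with * show "\<alpha> = \<beta> \<and> \<tau> = \<sigma>"
        using inj_onD[OF bij_betw_imp_inj_on[OF h]] by blast
    qed
    have "?z ` (increasing_seqs n k \<times> dyck_paths l) =
        (\<Union>\<tau>\<in>dyck_paths l. h \<tau> ` increasing_seqs n k)"
      by force
    also have "\<dots> = motzkin_paths n k"
      using bij_betw_imp_surj_on[OF h] by (simp add: assms(3) motzkin_paths_eq_insertions)
    finally show "?z ` (increasing_seqs n k \<times> dyck_paths l) = motzkin_paths n k" .
  qed
  then show ?thesis
    using weight by (intro exI[of _ ?z]) auto
qed

end
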